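(* Let $(G,\omega,\mu)$ be a weighted, infinite graph with $\lambda_1(G)>0$. Let $f:[0,+\infty)\to[0,+\infty)$ be a locally Lipschitz function. Assume that $f$ is increasing and $f(0)=0$. For a given $\delta>0$, let $L\equiv L(f,\delta)$ denote the Lipschitz constant of $f$ over the interval $[0,\delta]$. Suppose that $$L=\lambda_1(G).$$ Furthermore, assume that $u_0\in\ell^\infty(G)\cap\ell^1(G)$, $u_0\ge0$ in $G$, and $$\|u_0\|_{\ell^\infty(G)}\le\delta e^{-L\underline t},\qquad \|u_0\|_{\ell^1(G)}\le\frac{\delta}{\underline C},$$ for suitable positive constants $\underline C$ and $\underline t$, which are the ones appearing in the following heat kernel bound: let $x,y\in G$; for any $\underline t>0$ there exists $\underline C>0$ such that $p(x,y,t)\le\underline C\,e^{-\lambda_1(G)t}$ for all $t\ge\underline t$. Then there exists a global solution $u$ to the problem $u_t=\Delta u+f(u)$ in $G\times(0,+\infty)$, $u=u_0$ in $G\times\{0\}$; in addition, $u\in L^\infty((0,\infty);\ell^\infty(G))$.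
   Context: Weighted infinite graph: $G$ is a countably infinite set, $\mu:G\to(0,+\infty)$ is the node measure, and $\omega:G\times G\to[0,+\infty)$ is the edge weight, with $\omega(x,y)=\omega(y,x)$, $\omega(x,x)=0$ and $\sum_{y\in G}\omega(x,y)<\infty$ for all $x,y\in G$. Write $x\sim y$ if $\omega(x,y)>0$. The graph is always assumed locally finite (each $x$ has only finitely many $y\sim x$), connected (any two distinct vertices are joined by a finite path $x_0\sim x_1\sim\dots\sim x_n$) and undirected. Laplacian: $\Delta g(x)=\frac1{\mu(x)}\sum_{y\in G}[g(y)-g(x)]\,\omega(x,y)$ for $g:G\to\mathbb R$. $\ell^\infty(G)$ is the space of bounded functions on $G$ with the sup norm; $\|u\|_{\ell^1(G)}=\sum_{x\in G}|u(x)|\mu(x)$. $p:G\times G\times(0,+\infty)\to(0,+\infty)$ is the (minimal) heat kernel of the heat semigroup $e^{t\Delta}$: $(e^{t\Delta}u_0)(x)=\sum_{y\in G}p(x,y,t)u_0(y)\mu(y)$. The heat kernel bound quoted in the claim is stated in the paper as valid for every weighted infinite graph. $\lambda_1(G)=\inf\operatorname{spec}(-\Delta)$ is the infimum of the spectrum of $-\Delta$, realized as the self-adjoint operator on $\ell^2(G,\mu)$ generating the minimal heat semigroup. The Lipschitz constant of $f$ over $[0,\delta]$ is the smallest $L\ge0$ with $|f(a)-f(b)|\le L|a-b|$ for all $a,b\in[0,\delta]$. Solutions are mild: a (nonnegative) function $u\in L^\infty((0,\tau),\ell^\infty(G))$ is a mild solution on $G\times(0,\tau)$ if $$u(x,t)=\sum_{y\in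 G}p(x,y,t)u_0(y)\mu(y)+\int_0^t\sum_{y\in G}p(x,y,t-s)f(u(y,s))\mu(y)\,ds$$ for all $x\in G$, $t\in(0,\tau)$. A mild solution on $G\times(0,+\infty)$ is called global. *)

theory Defs
  imports "HOL-Analysis.Analysis"
begin

text \<open>The vertex set of the graph is the whole of a countable type.\<close>

locale weighted_graph =
  fixes \<mu> :: "'a::countable \<Rightarrow> real" and \<omega> :: "'a \<Rightarrow> 'a \<Rightarrow> real"
  assumes infinite_vertices: "infinite (UNIV :: 'a set)"
    and measure_pos: "\<mu> x > 0"
    and weight_nonneg: "\<omega> x y \<ge> 0"
    and weight_sym: "\<omega> x y = \<omega> y x"
    and weight_diag: "\<omega> x x = 0"
    and weight_summable: "\<omega> x summable_on UNIV"
    and locally_finite: "finite {y. \<omega> x y > 0}"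
    and connected: "(\<lambda>x y. \<omega> x y > 0)\<^sup>*\<^sup>* x y"

definition laplacian :: "('a \<Rightarrow> real) \<Rightarrow> ('a \<Rightarrow> 'a \<Rightarrow> real) \<Rightarrow> ('a \<Rightarrow> real) \<Rightarrow> 'a \<Rightarrow> real" where
  "laplacian \<mu> \<omega> g x = 1 / \<mu> x * (\<Sum>\<^sub>\<infinity>y. (g y - g x) * \<omega> x y)"

section \<open>Minimal heat kernel\<close>

text \<open>The minimal heat kernel is constructed by exhaustion, as the supremum over all finite
  vertex sets \<open>K\<close> of the Dirichlet heat kernels of \<open>K\<close>. The latter are the kernels, with respect
  to \<open>\<mu>\<close>, of the exponential of the (bounded) Laplacian on \<open>K\<close> with zero boundary condition.\<close>

definition dirichlet_laplacian ::
    "('a \<Rightarrow> real) \<Rightarrow> ('a \<Rightarrow> 'a \<Rightarrow> real) \<Rightarrow> 'a set \<Rightarrow> ('a \<Rightarrow> real) \<Rightarrow> 'a \<Rightarrow> real" where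
  "dirichlet_laplacian \<mu> \<omega> K g x =
     (if x \<in> K then laplacian \<mu> \<omega> (\<lambda>y. if y \<in> K then g y else 0) x else 0)"

text \<open>The intersection \<open>K \<inter> {y}\<close> makes the kernel vanish when \<open>y \<notin> K\<close>.\<close>

definition dirichlet_heat_kernel ::
    "('a \<Rightarrow> real) \<Rightarrow> ('a \<Rightarrow> 'a \<Rightarrow> real) \<Rightarrow> 'a set \<Rightarrow> 'a \<Rightarrow> 'a \<Rightarrow> real \<Rightarrow> real" where
  "dirichlet_heat_kernel \<mu> \<omega> K x y t =
     (\<Sum>n. t ^ n / fact n * ((dirichlet_laplacian \<mu> \<omega> K ^^ n) (indicat_real (K \<inter> {y}))) x) / \<mu> y"

definition heat_kernel ::
    "('a \<Rightarrow> real) \<Rightarrow> ('a \<Rightarrow> 'a \<Rightarrow> real) \<Rightarrow> 'a \<Rightarrow> 'a \<Rightarrow> real \<Rightarrow> real" where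
  "heat_kernel \<mu> \<omega> x y t = (SUP K\<in>{K. finite K}. dirichlet_heat_kernel \<mu> \<omega> K x y t)"

definition heat_semigroup ::
    "('a \<Rightarrow> real) \<Rightarrow> ('a \<Rightarrow> 'a \<Rightarrow> real) \<Rightarrow> real \<Rightarrow> ('a \<Rightarrow> real) \<Rightarrow> 'a \<Rightarrow> real" where
  "heat_semigroup \<mu> \<omega> t g x = (\<Sum>\<^sub>\<infinity>y. heat_kernel \<mu> \<omega> x y t * g y * \<mu> y)"

section \<open>Function spaces on the vertex set\<close>

definition ell_infinity :: "('a \<Rightarrow> real) set" where
  "ell_infinity = {g. bounded (range g)}"

definition ell_infinity_norm :: "('a \<Rightarrow> real) \<Rightarrow> real" where
  "ell_infinity_norm g = (SUP x. \<bar>g x\<bar>)"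

definition ell1 :: "('a \<Rightarrow> real) \<Rightarrow> ('a \<Rightarrow> real) set" where
  "ell1 \<mu> = {g. (\<lambda>x. \<bar>g x\<bar> * \<mu> x) summable_on UNIV}"

definition ell1_norm :: "('a \<Rightarrow> real) \<Rightarrow> ('a \<Rightarrow> real) \<Rightarrow> real" where
  "ell1_norm \<mu> g = (\<Sum>\<^sub>\<infinity>x. \<bar>g x\<bar> * \<mu> x)"

definition ell2 :: "('a \<Rightarrow> real) \<Rightarrow> ('a \<Rightarrow> real) set" where
  "ell2 \<mu> = {g. (\<lambda>x. (g x)\<^sup>2 * \<mu> x) summable_on UNIV}"

definition ell2_norm :: "('a \<Rightarrow> real) \<Rightarrow> ('a \<Rightarrow> real) \<Rightarrow> real" where
  "ell2_norm \<mu> g = sqrt (\<Sum>\<^sub>\<infinity>x. (g x)\<^sup>2 * \<mu> x)"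

section \<open>Bottom of the spectrum\<close>

text \<open>The graph, as a set of pairs, of the self-adjoint operator \<open>-\<Delta>\<close> on \<open>\<ell>\<^sup>2\<close>, that is, of minus
  the infinitesimal generator of the heat semigroup on \<open>\<ell>\<^sup>2\<close>: the pair \<open>(g, h)\<close> belongs to it when
  \<open>(g - e\<^sup>t\<^sup>\<Delta> g) / t\<close> converges to \<open>h\<close> in \<open>\<ell>\<^sup>2\<close> as \<open>t\<close> tends to \<open>0\<close> from the right.\<close>

definition neg_laplacian_ell2 ::
    "('a \<Rightarrow> real) \<Rightarrow> ('a \<Rightarrow> 'a \<Rightarrow> real) \<Rightarrow> (('a \<Rightarrow> real) \<times> ('a \<Rightarrow> real)) set" where
  "neg_laplacian_ell2 \<mu> \<omega> = {(g, h). g \<in> ell2 \<mu> \<and> h \<in> ell2 \<mu> \<and>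
     ((\<lambda>t. ell2_norm \<mu> (\<lambda>x. (g x - heat_semigroup \<mu> \<omega> t g x) / t - h x)) \<longlongrightarrow> 0) (at_right 0)}"

text \<open>\<open>\<kappa>\<close> is in the resolvent set if \<open>-\<Delta> - \<kappa>\<close> is a bijection from its domain onto \<open>\<ell>\<^sup>2\<close> with bounded
  inverse. As the operator is self-adjoint, its spectrum is real, so real scalars suffice.\<close>

definition resolvent_set :: "('a \<Rightarrow> real) \<Rightarrow> ('a \<Rightarrow> 'a \<Rightarrow> real) \<Rightarrow> real set" where
  "resolvent_set \<mu> \<omega> = {\<kappa>.
     (\<forall>w\<in>ell2 \<mu>. \<exists>!g. \<exists>h. (g, h) \<in> neg_laplacian_ell2 \<mu> \<omega> \<and> (\<forall>x. h x - \<kappa> * g x = w x)) \<and>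
     (\<exists>B. \<forall>(g, h)\<in>neg_laplacian_ell2 \<mu> \<omega>.
        ell2_norm \<mu> g \<le> B * ell2_norm \<mu> (\<lambda>x. h x - \<kappa> * g x))}"

definition spectrum :: "('a \<Rightarrow> real) \<Rightarrow> ('a \<Rightarrow> 'a \<Rightarrow> real) \<Rightarrow> real set" where
  "spectrum \<mu> \<omega> = - resolvent_set \<mu> \<omega>"

definition lambda1 :: "('a \<Rightarrow> real) \<Rightarrow> ('a \<Rightarrow> 'a \<Rightarrow> real) \<Rightarrow> real" where
  "lambda1 \<mu> \<omega> = Inf (spectrum \<mu> \<omega>)"

section \<open>Mild solutions\<close>

definition lipschitz_const :: "real set \<Rightarrow> (real \<Rightarrow> real) \<Rightarrow> real" where
  "lipschitz_const S f = (LEAST L. L-lipschitz_on S f)"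

definition time_interval :: "ereal \<Rightarrow> real set" where
  "time_interval \<tau> = {t. 0 < t \<and> ereal t < \<tau>}"

text \<open>The space \<open>L\<^sup>\<infinity>((0,\<tau>), \<ell>\<^sup>\<infinity>)\<close>. Measurability of \<open>u : (0,\<tau>) \<rightarrow> \<ell>\<^sup>\<infinity>\<close> is understood vertex by
  vertex; \<open>\<ell>\<^sup>\<infinity>\<close> is not separable, and strong measurability for the supremum norm cannot be
  expected, as the heat semigroup need not be strongly continuous on \<open>\<ell>\<^sup>\<infinity>\<close>.\<close>

definition Linf_ell_infinity :: "ereal \<Rightarrow> ('a \<Rightarrow> real \<Rightarrow> real) set" where
  "Linf_ell_infinity \<tau> = {u.
     (\<forall>t\<in>time_interval \<tau>. (\<lambda>x. u x t) \<in> ell_infinity) \<and>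
     (\<forall>x. u x \<in> borel_measurable (lebesgue_on (time_interval \<tau>))) \<and>
     (\<exists>M. AE t in lebesgue_on (time_interval \<tau>). ell_infinity_norm (\<lambda>x. u x t) \<le> M)}"

text \<open>For a nonnegative \<open>u\<close> in this space and \<open>f\<close> nonnegative, continuous and bounded on bounded
  sets, the sums and the integral below converge, because \<open>\<Sum>y. p(x,y,t) \<mu>(y) \<le> 1\<close>.\<close>

definition mild_solution ::
    "('a \<Rightarrow> real) \<Rightarrow> ('a \<Rightarrow> 'a \<Rightarrow> real) \<Rightarrow> (real \<Rightarrow> real) \<Rightarrow> ('a \<Rightarrow> real) \<Rightarrow> ereal
      \<Rightarrow> ('a \<Rightarrow> real \<Rightarrow> real) \<Rightarrow> bool" where
  "mild_solution \<mu> \<omega> f u\<^sub>0 \<tau> u \<longleftrightarrow>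
     u \<in> Linf_ell_infinity \<tau> \<and>
     (\<forall>x. \<forall>t\<in>time_interval \<tau>. u x t \<ge> 0) \<and>
     (\<forall>x. \<forall>t\<in>time_interval \<tau>.
        u x t = (\<Sum>\<^sub>\<infinity>y. heat_kernel \<mu> \<omega> x y t * u\<^sub>0 y * \<mu> y)
          + (LINT s:{0<..<t}|lebesgue. \<Sum>\<^sub>\<infinity>y. heat_kernel \<mu> \<omega> x y (t - s) * f (u y s) * \<mu> y))"

definition global_solution ::
    "('a \<Rightarrow> real) \<Rightarrow> ('a \<Rightarrow> 'a \<Rightarrow> real) \<Rightarrow> (real \<Rightarrow> real) \<Rightarrow> ('a \<Rightarrow> real)
      \<Rightarrow> ('a \<Rightarrow> real \<Rightarrow> real) \<Rightarrow> bool" where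
  "global_solution \<mu> \<omega> f u\<^sub>0 u \<longleftrightarrow> mild_solution \<mu> \<omega> f u\<^sub>0 \<infinity> u"

end

theory Submission
  imports Defs
begin

text \<open>
  Let \<open>P\<^sub>t\<close> be the heat semigroup. The function \<open>e\<^sup>L\<^sup>t P\<^sub>t u\<^sub>0\<close> is a supersolution as long as it stays
  below \<open>\<delta>\<close>, since \<open>f r \<le> L r\<close> on \<open>[0, \<delta>]\<close>. It does stay below \<open>\<delta>\<close>: for \<open>t < t\<^sub>0\<close> because
  \<open>P\<^sub>t u\<^sub>0 \<le> \<parallel>u\<^sub>0\<parallel>\<^sub>\<infinity>\<close>, and for \<open>t \<ge> t\<^sub>0\<close> because \<open>P\<^sub>t u\<^sub>0 \<le> C e\<^sup>-\<^sup>L\<^sup>t \<parallel>u\<^sub>0\<parallel>\<^sub>1\<close>. Monotone iteration of the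
  mild formulation, started at \<open>0\<close>, therefore converges to a solution bounded by \<open>\<delta>\<close>. The only
  properties of the minimal heat kernel that enter are its mass bound and the Chapman-Kolmogorov
  inequality; both pass to the limit from the Dirichlet kernels of finite sets, which are
  exponentials of matrices with nonnegative off-diagonal entries and nonpositive row sums.
\<close>

section \<open>Exponentials of finite kernels\<close>

primrec kernel_pow :: "'a set \<Rightarrow> ('a \<Rightarrow> 'a \<Rightarrow> real) \<Rightarrow> nat \<Rightarrow> 'a \<Rightarrow> 'a \<Rightarrow> real" where
  "kernel_pow K a 0 x y = of_bool (x = y)"
| "kernel_pow K a (Suc n) x y = (\<Sum>z\<in>K. a x z * kernel_pow K a n z y)"

definition kernel_exp :: "'a set \<Rightarrow> ('a \<Rightarrow> 'a \<Rightarrow> real) \<Rightarrow> real \<Rightarrow> 'a \<Rightarrow> 'a \<Rightarrow> real" where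
  "kernel_exp K a t x y = (\<Sum>n. t ^ n / fact n * kernel_pow K a n x y)"

lemma kernel_pow_add:
  assumes "finite K" "x \<in> K"
  shows "kernel_pow K a (m + n) x y = (\<Sum>z\<in>K. kernel_pow K a m x z * kernel_pow K a n z y)"
  using assms(2)
proof (induction m arbitrary: x)
  case 0
  have "(\<Sum>z\<in>K. kernel_pow K a 0 x z * kernel_pow K a n z y)
      = (\<Sum>z\<in>K. if x = z then kernel_pow K a n z y else 0)"
    by (intro sum.cong) auto
  then show ?case using assms(1) 0 by simp
next
  case (Suc m)
  have "kernel_pow K a (Suc m + n) x y
      = (\<Sum>w\<in>K. a x w * (\<Sum>z\<in>K. kernel_pow K a m w z * kernel_pow K a n z y))"
    using Suc by simp
  also have "\<dots> = (\<Sum>w\<in>K. \<Sum>z\<in>K. a x w * kernel_pow K a m w z * kernel_pow K a n z y)"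
    by (simp add: sum_distrib_left mult.assoc)
  also have "\<dots> = (\<Sum>z\<in>K. \<Sum>w\<in>K. a x w * kernel_pow K a m w z * kernel_pow K a n z y)"
    by (rule sum.swap)
  finally show ?case by (simp add: sum_distrib_right)
qed

lemma abs_kernel_pow_le:
  assumes "finite K" "x \<in> K"
  shows "\<bar>kernel_pow K a n x y\<bar> \<le> (\<Sum>x\<in>K. \<Sum>z\<in>K. \<bar>a x z\<bar>) ^ n"
  using assms(2)
proof (induction n arbitrary: x)
  case (Suc n)
  let ?B = "\<Sum>x\<in>K. \<Sum>z\<in>K. \<bar>a x z\<bar>"
  have "\<bar>kernel_pow K a (Suc n) x y\<bar> \<le> (\<Sum>z\<in>K. \<bar>a x z * kernel_pow K a n z y\<bar>)"
    by (simp add: sum_abs)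
  also have "\<dots> \<le> (\<Sum>z\<in>K. \<bar>a x z\<bar> * ?B ^ n)"
    using Suc.IH by (intro sum_mono) (auto simp: abs_mult intro: mult_left_mono)
  also have "\<dots> = (\<Sum>z\<in>K. \<bar>a x z\<bar>) * ?B ^ n" by (simp add: sum_distrib_right)
  also have "\<dots> \<le> ?B * ?B ^ n"
    using assms(1) Suc.prems
    by (intro mult_right_mono member_le_sum zero_le_power sum_nonneg) auto
  finally show ?case by simp
qed simp

lemma summable_norm_kernel_exp:
  assumes "finite K" "x \<in> K"
  shows "summable (\<lambda>n. norm (t ^ n / fact n * kernel_pow K a n x y))"
proof -
  define B where "B = (\<Sum>x\<in>K. \<Sum>z\<in>K. \<bar>a x z\<bar>)"
  have "summable (\<lambda>n. (\<bar>t\<bar> * B) ^ n / fact n)"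
    using summable_exp[of "\<bar>t\<bar> * B"] by (simp add: divide_inverse mult.commute)
  moreover have "norm (norm (t ^ n / fact n * kernel_pow K a n x y)) \<le> (\<bar>t\<bar> * B) ^ n / fact n" for n
  proof -
    have "\<bar>t ^ n / fact n * kernel_pow K a n x y\<bar> = \<bar>t\<bar> ^ n / fact n * \<bar>kernel_pow K a n x y\<bar>"
      by (simp add: abs_mult power_abs)
    also have "\<dots> \<le> \<bar>t\<bar> ^ n / fact n * B ^ n"
      unfolding B_def by (intro mult_left_mono abs_kernel_pow_le assms) auto
    finally show ?thesis by (simp add: power_mult_distrib)
  qed
  ultimately show ?thesis
    by (rule summable_comparison_test')
qed

lemma kernel_exp_sums:
  assumes "finite K" "x \<in> K"
  shows "(\<lambda>n. t ^ n / fact n * kernel_pow K a n x y) sums kernel_exp K a t x y"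
  unfolding kernel_exp_def
  using summable_norm_kernel_exp[OF assms] by (intro summable_sums) (rule summable_norm_cancel)

lemma exp_term_convolution:
  fixes s t :: real
  assumes "\<And>i. i \<le> n \<Longrightarrow> of_nat (n choose i) * b i = c i"
  shows "(\<Sum>i\<le>n. s ^ i / fact i * (t ^ (n - i) / fact (n - i)) * b i)
      = (\<Sum>i\<le>n. s ^ i * t ^ (n - i) * c i) / fact n"
proof -
  have "s ^ i / fact i * (t ^ (n - i) / fact (n - i)) * b i = s ^ i * t ^ (n - i) * c i / fact n"
    if "i \<le> n" for i
    using assms[OF that, symmetric] binomial_fact[OF that, where 'a = real]
    by (simp add: field_simps)
  then show ?thesis by (simp add: sum_divide_distrib)
qed

lemma kernel_exp_add:
  assumes "finite K" "x \<in> K"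
  shows "kernel_exp K a (s + t) x y = (\<Sum>z\<in>K. kernel_exp K a s x z * kernel_exp K a t z y)"
proof -
  let ?e = "\<lambda>t x y n. t ^ n / fact n * kernel_pow K a n x y"
  have "(\<lambda>n. \<Sum>z\<in>K. \<Sum>i\<le>n. ?e s x z i * ?e t z y (n - i))
      sums (\<Sum>z\<in>K. kernel_exp K a s x z * kernel_exp K a t z y)"
    using assms unfolding kernel_exp_def
    by (intro sums_sum Cauchy_product_sums summable_norm_kernel_exp)
  moreover have "(\<Sum>z\<in>K. \<Sum>i\<le>n. ?e s x z i * ?e t z y (n - i)) = ?e (s + t) x y n" for n
  proof -
    have "(\<Sum>z\<in>K. \<Sum>i\<le>n. ?e s x z i * ?e t z y (n - i))
        = (\<Sum>i\<le>n. s ^ i / fact i * (t ^ (n - i) / fact (n - i))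
            * (\<Sum>z\<in>K. kernel_pow K a i x z * kernel_pow K a (n - i) z y))"
      by (subst sum.swap) (simp add: sum_distrib_left mult_ac)
    also have "\<dots> = (\<Sum>i\<le>n. s ^ i / fact i * (t ^ (n - i) / fact (n - i)) * kernel_pow K a n x y)"
      using assms by (intro sum.cong refl) (simp add: kernel_pow_add[symmetric])
    also have "\<dots> = (\<Sum>i\<le>n. s ^ i * t ^ (n - i) * (of_nat (n choose i) * kernel_pow K a n x y)) / fact n"
      by (rule exp_term_convolution) simp
    also have "\<dots> = ?e (s + t) x y n"
      by (simp add: binomial_ring sum_distrib_left sum_divide_distrib mult_ac)
    finally show ?thesis .
  qed
  ultimately have "?e (s + t) x y sums (\<Sum>z\<in>K. kernel_exp K a s x z * kernel_exp K a t z y)"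
    by simp
  then show ?thesis
    by (rule sums_unique2[OF kernel_exp_sums[OF assms]])
qed

lemma kernel_pow_shift:
  assumes "finite K" "x \<in> K"
  shows "kernel_pow K (\<lambda>x z. a x z + q * of_bool (x = z)) n x y
      = (\<Sum>i\<le>n. of_nat (n choose i) * q ^ (n - i) * kernel_pow K a i x y)"
  using assms(2)
proof (induction n arbitrary: x)
  case (Suc n)
  let ?b = "\<lambda>x z. a x z + q * of_bool (x = z)" and ?p = "\<lambda>i. kernel_pow K a i x y"
  have "kernel_pow K ?b (Suc n) x y
      = (\<Sum>z\<in>K. a x z * kernel_pow K ?b n z y)
        + (\<Sum>z\<in>K. if x = z then q * kernel_pow K ?b n z y else 0)"
    by (simp add: distrib_right sum.distrib if_distrib cong: if_cong)
       (intro sum.cong, auto)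
  also have "\<dots> = (\<Sum>z\<in>K. a x z * kernel_pow K ?b n z y) + q * kernel_pow K ?b n x y"
    using assms(1) Suc.prems by simp
  also have "(\<Sum>z\<in>K. a x z * kernel_pow K ?b n z y)
      = (\<Sum>i\<le>n. of_nat (n choose i) * q ^ (n - i) * ?p (Suc i))"
    using Suc.IH by (simp add: sum_distrib_left, subst sum.swap, simp add: mult_ac)
  also have "q * kernel_pow K ?b n x y = (\<Sum>i\<le>n. of_nat (n choose i) * q ^ (Suc n - i) * ?p i)"
    using Suc by (simp add: sum_distrib_left Suc_diff_le mult_ac)
  also have "(\<Sum>i\<le>n. of_nat (n choose i) * q ^ (Suc n - i) * ?p i)
      = (\<Sum>i\<le>Suc n. of_nat (n choose i) * q ^ (Suc n - i) * ?p i)"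
    by simp
  also have "\<dots> = q ^ Suc n * ?p 0 + (\<Sum>i\<le>n. of_nat (n choose Suc i) * q ^ (n - i) * ?p (Suc i))"
    by (subst sum.atMost_Suc_shift) simp
  also have "(\<Sum>i\<le>n. of_nat (n choose i) * q ^ (n - i) * ?p (Suc i)) + \<dots>
      = q ^ Suc n * ?p 0 + (\<Sum>i\<le>n. of_nat (Suc n choose Suc i) * q ^ (n - i) * ?p (Suc i))"
    by (simp add: sum.distrib distrib_right)
  also have "\<dots> = (\<Sum>i\<le>Suc n. of_nat (Suc n choose i) * q ^ (Suc n - i) * ?p i)"
    by (subst sum.atMost_Suc_shift) simp
  finally show ?case .
qed simp

lemma kernel_exp_shift:
  assumes "finite K" "x \<in> K"
  shows "kernel_exp K (\<lambda>x z. a x z + q * of_bool (x = z)) t x y = exp (q * t) * kernel_exp K a t x y"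
proof -
  let ?b = "\<lambda>x z. a x z + q * of_bool (x = z)"
  let ?e = "\<lambda>n. t ^ n / fact n * kernel_pow K a n x y" and ?g = "\<lambda>n. (q * t) ^ n / fact n"
  have g: "summable (\<lambda>n. norm (?g n))" "(\<Sum>n. ?g n) = exp (q * t)"
    using summable_norm_exp[of "q * t"] by (simp_all add: exp_def field_simps)
  have "(\<lambda>n. \<Sum>i\<le>n. ?e i * ?g (n - i)) sums (kernel_exp K a t x y * exp (q * t))"
    unfolding kernel_exp_def g(2)[symmetric] using g(1) assms
    by (intro Cauchy_product_sums summable_norm_kernel_exp)
  moreover have "(\<Sum>i\<le>n. ?e i * ?g (n - i)) = t ^ n / fact n * kernel_pow K ?b n x y" for n
  proof -
    have "(\<Sum>i\<le>n. ?e i * ?g (n - i))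
       = (\<Sum>i\<le>n. t ^ i / fact i * (t ^ (n - i) / fact (n - i)) * (q ^ (n - i) * kernel_pow K a i x y))"
      by (intro sum.cong) (simp_all add: power_mult_distrib)
    also have "\<dots> = (\<Sum>i\<le>n. t ^ i * t ^ (n - i)
        * (of_nat (n choose i) * q ^ (n - i) * kernel_pow K a i x y)) / fact n"
      by (rule exp_term_convolution) simp
    also have "\<dots> = (\<Sum>i\<le>n. t ^ n
        * (of_nat (n choose i) * q ^ (n - i) * kernel_pow K a i x y)) / fact n"
      by (simp add: power_add[symmetric])
    finally show ?thesis
      by (simp only: kernel_pow_shift[OF assms] sum_distrib_left[symmetric] times_divide_eq_left)
  qed
  ultimately have "(\<lambda>n. t ^ n / fact n * kernel_pow K ?b n x y) sums (kernel_exp K a t x y * exp (q * t))"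
    by simp
  from sums_unique2[OF kernel_exp_sums[OF assms] this] show ?thesis
    by simp
qed

lemma kernel_pow_nonneg:
  assumes "\<And>x z. x \<in> K \<Longrightarrow> z \<in> K \<Longrightarrow> 0 \<le> a x z" "x \<in> K"
  shows "0 \<le> kernel_pow K a n x y"
  using assms(2) by (induction n arbitrary: x) (auto intro!: sum_nonneg mult_nonneg_nonneg assms(1))

lemma kernel_pow_mono:
  assumes "finite K'" "K \<subseteq> K'" "\<And>x z. x \<in> K' \<Longrightarrow> z \<in> K' \<Longrightarrow> 0 \<le> a x z" "x \<in> K"
  shows "kernel_pow K a n x y \<le> kernel_pow K' a n x y"
  using assms(4)
proof (induction n arbitrary: x)
  case (Suc n)
  have "kernel_pow K a (Suc n) x y \<le> (\<Sum>z\<in>K. a x z * kernel_pow K' a n z y)"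
    unfolding kernel_pow.simps using Suc.IH Suc.prems assms(2)
    by (intro sum_mono mult_left_mono assms(3)) auto
  also have "\<dots> \<le> kernel_pow K' a (Suc n) x y"
    unfolding kernel_pow.simps
    using Suc.prems assms(1,2) by (intro sum_mono2 mult_nonneg_nonneg kernel_pow_nonneg assms(3)) auto
  finally show ?case .
qed simp

lemma sum_kernel_pow_le:
  assumes "finite K" "\<And>x z. x \<in> K \<Longrightarrow> z \<in> K \<Longrightarrow> 0 \<le> a x z"
    and "\<And>x. x \<in> K \<Longrightarrow> (\<Sum>z\<in>K. a x z) \<le> q" "x \<in> K"
  shows "(\<Sum>y\<in>K. kernel_pow K a n x y) \<le> q ^ n"
  using assms(4)
proof (induction n arbitrary: x)
  case 0
  then show ?case using assms(1) by (simp add: of_bool_def)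
next
  case (Suc n)
  have q: "0 \<le> q" using assms(2) assms(3)[OF Suc.prems] Suc.prems
    by (meson order_trans sum_nonneg)
  have "(\<Sum>y\<in>K. kernel_pow K a (Suc n) x y) = (\<Sum>z\<in>K. a x z * (\<Sum>y\<in>K. kernel_pow K a n z y))"
    by (simp add: sum_distrib_left) (rule sum.swap)
  also have "\<dots> \<le> (\<Sum>z\<in>K. a x z * q ^ n)"
    using Suc assms(2) by (intro sum_mono mult_left_mono) auto
  also have "\<dots> \<le> q * q ^ n"
    unfolding sum_distrib_right[symmetric] using assms(3) Suc.prems q
    by (intro mult_right_mono) auto
  finally show ?case by simp
qed

text \<open>Off-diagonal positivity suffices: a diagonal shift of the generator only rescales the exponential.\<close>

lemma diagonal_shift_nonneg:
  fixes a :: "'a \<Rightarrow> 'a \<Rightarrow> real"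
  assumes "finite K" "\<And>x z. x \<noteq> z \<Longrightarrow> 0 \<le> a x z" "x \<in> K"
  shows "0 \<le> a x z + (\<Sum>x\<in>K. \<bar>a x x\<bar>) * of_bool (x = z)"
  using assms member_le_sum[OF assms(3), of "\<lambda>x. \<bar>a x x\<bar>"] by (cases "x = z") auto

lemma kernel_exp_nonneg:
  assumes "finite K" "\<And>x z. x \<noteq> z \<Longrightarrow> 0 \<le> a x z" "x \<in> K" "0 \<le> t"
  shows "0 \<le> kernel_exp K a t x y"
proof -
  define q where "q = (\<Sum>x\<in>K. \<bar>a x x\<bar>)"
  have q: "0 \<le> a x z + q * of_bool (x = z)" if "x \<in> K" for x z
    unfolding q_def by (rule diagonal_shift_nonneg) (use assms that in auto)
  let ?b = "\<lambda>x z. a x z + q * of_bool (x = z)"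
  have "0 \<le> kernel_exp K ?b t x y"
    using assms(3,4)
    by (intro sums_le[OF _ sums_zero kernel_exp_sums[OF assms(1,3)]] mult_nonneg_nonneg
        kernel_pow_nonneg q) auto
  then show ?thesis
    unfolding kernel_exp_shift[OF assms(1,3)] using zero_le_mult_iff not_exp_le_zero by blast
qed

lemma kernel_exp_mono:
  assumes "finite K'" "K \<subseteq> K'" "\<And>x z. x \<noteq> z \<Longrightarrow> 0 \<le> a x z" "x \<in> K" "0 \<le> t"
  shows "kernel_exp K a t x y \<le> kernel_exp K' a t x y"
proof -
  have K: "finite K" "x \<in> K'" using assms finite_subset by auto
  define q where "q = (\<Sum>x\<in>K'. \<bar>a x x\<bar>)"
  have q: "0 \<le> a x z + q * of_bool (x = z)" if "x \<in> K'" for x z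
    unfolding q_def by (rule diagonal_shift_nonneg) (use assms that in auto)
  let ?b = "\<lambda>x z. a x z + q * of_bool (x = z)"
  have "t ^ n / fact n * kernel_pow K ?b n x y \<le> t ^ n / fact n * kernel_pow K' ?b n x y" for n
    using assms(1,2,4,5) by (intro mult_left_mono kernel_pow_mono q) simp_all
  then have "kernel_exp K ?b t x y \<le> kernel_exp K' ?b t x y"
    by (rule sums_le[OF _ kernel_exp_sums[OF K(1) assms(4)] kernel_exp_sums[OF assms(1) K(2)]])
  then have "exp (q * t) * kernel_exp K a t x y \<le> exp (q * t) * kernel_exp K' a t x y"
    by (simp only: kernel_exp_shift[OF K(1) assms(4)] kernel_exp_shift[OF assms(1) K(2)])
  then show ?thesis by simp
qed

lemma sum_kernel_exp_le_1:
  assumes "finite K" "\<And>x z. x \<noteq> z \<Longrightarrow> 0 \<le> a x z" "\<And>x. x \<in> K \<Longrightarrow> (\<Sum>z\<in>K. a x z) \<le> 0"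
    and "x \<in> K" "0 \<le> t"
  shows "(\<Sum>y\<in>K. kernel_exp K a t x y) \<le> 1"
proof -
  define q where "q = (\<Sum>x\<in>K. \<bar>a x x\<bar>)"
  have q: "0 \<le> a x z + q * of_bool (x = z)" if "x \<in> K" for x z
    unfolding q_def by (rule diagonal_shift_nonneg) (use assms that in auto)
  let ?b = "\<lambda>x z. a x z + q * of_bool (x = z)"
  have row: "(\<Sum>z\<in>K. ?b x z) \<le> q" if "x \<in> K" for x
  proof -
    have "(\<Sum>z\<in>K. q * of_bool (x = z)) = (\<Sum>z\<in>K. if x = z then q else 0)"
      by (intro sum.cong) auto
    then show ?thesis
      using assms(1) assms(3)[OF that] that by (simp add: sum.distrib)
  qed
  have "(\<lambda>n. \<Sum>y\<in>K. t ^ n / fact n * kernel_pow K ?b n x y) sums (\<Sum>y\<in>K. kernel_exp K ?b t x y)"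
    by (intro sums_sum kernel_exp_sums assms)
  moreover have "(\<lambda>n. t ^ n / fact n * q ^ n) sums exp (q * t)"
    using exp_converges[of "q * t"] by (simp add: divide_inverse power_mult_distrib mult_ac)
  moreover have "(\<Sum>y\<in>K. t ^ n / fact n * kernel_pow K ?b n x y) \<le> t ^ n / fact n * q ^ n" for n
    unfolding sum_distrib_left[symmetric] using assms(1,4,5)
    by (intro mult_left_mono sum_kernel_pow_le q row) simp_all
  ultimately have "(\<Sum>y\<in>K. kernel_exp K ?b t x y) \<le> exp (q * t)"
    by (rule sums_le[rotated])
  then show ?thesis
    unfolding kernel_exp_shift[OF assms(1,4)] sum_distrib_left[symmetric] by simp
qed

section \<open>Infinite sums as integrals\<close>

lemma infsum_eq_enn2real_nn_integral:
  fixes f :: "'a \<Rightarrow> real"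
  assumes "\<And>x. 0 \<le> f x"
  shows "infsum f UNIV = enn2real (\<integral>\<^sup>+x. ennreal (f x) \<partial>count_space UNIV)"
proof -
  have "infsum f UNIV = infsetsum f UNIV"
  proof (cases "f summable_on UNIV")
    case True
    then have "Infinite_Set_Sum.abs_summable_on f UNIV"
      using summable_on_iff_abs_summable_on_real abs_summable_equivalent by blast
    then show ?thesis by (simp add: infsetsum_infsum)
  next
    case False
    then have "\<not> Infinite_Set_Sum.abs_summable_on f UNIV"
      using summable_on_iff_abs_summable_on_real abs_summable_equivalent by blast
    with False show ?thesis by (simp add: infsum_not_exists not_summable_infsetsum_eq)
  qed
  also have "\<dots> = enn2real (\<integral>\<^sup>+x. ennreal (f x) \<partial>count_space UNIV)"
    unfolding infsetsum_def using assms by (intro integral_eq_nn_integral) auto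
  finally show ?thesis .
qed

lemma nn_integral_count_space_eq_infsum:
  fixes f :: "'a \<Rightarrow> real"
  assumes "\<And>x. 0 \<le> f x" "f summable_on UNIV"
  shows "(\<integral>\<^sup>+x. ennreal (f x) \<partial>count_space UNIV) = ennreal (infsum f UNIV)"
proof -
  have "Infinite_Set_Sum.abs_summable_on f UNIV"
    using assms(2) summable_on_iff_abs_summable_on_real abs_summable_equivalent by blast
  then have "integrable (count_space UNIV) f"
    by (simp add: abs_summable_on_def)
  then show ?thesis
    using assms(1) nn_integral_eq_integral[of "count_space UNIV" f]
    by (simp add: infsum_eq_enn2real_nn_integral integral_nonneg_AE)
qed

lemma nn_integral_count_space_le:
  fixes f :: "'a \<Rightarrow> real"
  assumes "\<And>x. 0 \<le> f x" "\<And>F. finite F \<Longrightarrow> sum f F \<le> c"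
  shows "(\<integral>\<^sup>+x. ennreal (f x) \<partial>count_space UNIV) \<le> ennreal c"
proof -
  have "f summable_on UNIV"
    using assms by (intro nonneg_bdd_above_summable_on bdd_aboveI2[where M = c]) auto
  then show ?thesis
    using assms by (auto simp: nn_integral_count_space_eq_infsum intro!: ennreal_leI infsum_le_finite_sums)
qed

lemma borel_measurable_nn_integral_count_space:
  fixes f :: "'a::countable \<Rightarrow> 'b \<Rightarrow> ennreal"
  assumes "\<And>y. f y \<in> borel_measurable M"
  shows "(\<lambda>x. \<integral>\<^sup>+y. f y x \<partial>count_space UNIV) \<in> borel_measurable M"
proof -
  interpret sigma_finite_measure "count_space (UNIV :: 'a set)"
    by (rule sigma_finite_measure_count_space)
  have "(\<lambda>p. f (snd p) (fst p)) \<in> borel_measurable (M \<Otimes>\<^sub>M count_space UNIV)"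
    by (rule measurable_compose_countable[where f = "\<lambda>y p. f y (fst p)" and g = snd])
      (auto intro: measurable_compose[OF measurable_fst assms])
  then show ?thesis
    by (intro borel_measurable_nn_integral) (simp add: case_prod_beta')
qed

section \<open>The minimal heat kernel\<close>

definition laplacian_entry ::
    "('a \<Rightarrow> real) \<Rightarrow> ('a \<Rightarrow> 'a \<Rightarrow> real) \<Rightarrow> 'a \<Rightarrow> 'a \<Rightarrow> real" where
  "laplacian_entry \<mu> \<omega> x z = (\<omega> x z - of_bool (x = z) * (\<Sum>\<^sub>\<infinity>y. \<omega> x y)) / \<mu> x"

context weighted_graph
begin

abbreviation "dhk \<equiv> dirichlet_heat_kernel \<mu> \<omega>"
abbreviation "hk \<equiv> heat_kernel \<mu> \<omega>"

lemma dirichlet_laplacian_eq_sum: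
  assumes "finite K" "x \<in> K"
  shows "dirichlet_laplacian \<mu> \<omega> K g x = (\<Sum>z\<in>K. laplacian_entry \<mu> \<omega> x z * g z)"
proof -
  let ?h = "\<lambda>y. (if y \<in> K then g y else 0) * \<omega> x y"
  have h: "?h summable_on UNIV" "infsum ?h UNIV = (\<Sum>y\<in>K. g y * \<omega> x y)"
  proof -
    show "?h summable_on UNIV"
      using summable_on_cong_neutral[of UNIV K ?h ?h] assms(1) by (auto simp: summable_on_finite)
    have "infsum ?h UNIV = infsum ?h K"
      by (rule infsum_cong_neutral) auto
    then show "infsum ?h UNIV = (\<Sum>y\<in>K. g y * \<omega> x y)"
      using assms(1) by simp
  qed
  have "(\<Sum>\<^sub>\<infinity>y. ((if y \<in> K then g y else 0) - g x) * \<omega> x y)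
      = (\<Sum>\<^sub>\<infinity>y. ?h y + - g x * \<omega> x y)"
    by (simp add: left_diff_distrib)
  also have "\<dots> = infsum ?h UNIV + (\<Sum>\<^sub>\<infinity>y. - g x * \<omega> x y)"
    using h(1) weight_summable by (simp only: infsum_add summable_on_cmult_right)
  also have "\<dots> = (\<Sum>y\<in>K. g y * \<omega> x y) - g x * (\<Sum>\<^sub>\<infinity>y. \<omega> x y)"
    by (simp only: h(2) infsum_cmult_right')
  also have "\<dots> = (\<Sum>z\<in>K. \<mu> x * laplacian_entry \<mu> \<omega> x z * g z)"
  proof -
    have "(\<Sum>z\<in>K. \<mu> x * laplacian_entry \<mu> \<omega> x z * g z)
      = (\<Sum>z\<in>K. g z * \<omega> x z - (if x = z then g z * (\<Sum>\<^sub>\<infinity>y. \<omega> x y) else 0))"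
      using measure_pos[of x] by (intro sum.cong) (auto simp: laplacian_entry_def field_simps)
    then show ?thesis using assms by (simp add: sum_subtractf)
  qed
  finally show ?thesis
    using assms(2) measure_pos[of x]
    by (simp add: dirichlet_laplacian_def laplacian_def sum_divide_distrib)
qed

lemma dirichlet_laplacian_funpow:
  assumes "finite K" "x \<in> K" "y \<in> K"
  shows "(dirichlet_laplacian \<mu> \<omega> K ^^ n) (indicat_real (K \<inter> {y})) x
    = kernel_pow K (laplacian_entry \<mu> \<omega>) n x y"
  using assms(2)
proof (induction n arbitrary: x)
  case 0
  then show ?case using assms by (auto simp: indicator_def)
next
  case (Suc n)
  then show ?case using assms(1) by (simp add: dirichlet_laplacian_eq_sum)
qed

lemma dirichlet_heat_kernel_eq:
  assumes "finite K" "x \<in> K" "y \<in> K"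
  shows "dhk K x y t = kernel_exp K (laplacian_entry \<mu> \<omega>) t x y / \<mu> y"
  unfolding dirichlet_heat_kernel_def kernel_exp_def dirichlet_laplacian_funpow[OF assms] ..

lemma dirichlet_heat_kernel_outside:
  assumes "x \<notin> K \<or> y \<notin> K"
  shows "dhk K x y t = 0"
proof -
  have "(dirichlet_laplacian \<mu> \<omega> K ^^ n) (indicat_real (K \<inter> {y})) x = 0" for n
  proof (cases "y \<in> K")
    case True
    then show ?thesis using assms by (cases n) (auto simp: dirichlet_laplacian_def indicator_def)
  next
    case False
    have "(dirichlet_laplacian \<mu> \<omega> K ^^ n) (indicat_real (K \<inter> {y})) = (\<lambda>_. 0)"
      using False by (induction n) (auto simp: dirichlet_laplacian_def laplacian_def)
    then show ?thesis by simp
  qed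
  then show ?thesis by (simp add: dirichlet_heat_kernel_def)
qed

lemma laplacian_entry_nonneg: "x \<noteq> z \<Longrightarrow> 0 \<le> laplacian_entry \<mu> \<omega> x z"
  using weight_nonneg measure_pos[of x] by (simp add: laplacian_entry_def)

lemma sum_laplacian_entry_le_0:
  assumes "finite K" "x \<in> K"
  shows "(\<Sum>z\<in>K. laplacian_entry \<mu> \<omega> x z) \<le> 0"
proof -
  have "(\<Sum>z\<in>K. laplacian_entry \<mu> \<omega> x z)
      = (\<Sum>z\<in>K. \<omega> x z - (if x = z then \<Sum>\<^sub>\<infinity>y. \<omega> x y else 0)) / \<mu> x"
    by (auto simp: laplacian_entry_def sum_divide_distrib intro!: sum.cong)
  also have "\<dots> = ((\<Sum>z\<in>K. \<omega> x z) - (\<Sum>\<^sub>\<infinity>y. \<omega> x y)) / \<mu> x"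
    using assms by (simp add: sum_subtractf)
  also have "\<dots> \<le> 0"
    using finite_sum_le_infsum[OF weight_summable assms(1)] weight_nonneg measure_pos[of x]
    by (simp add: divide_le_0_iff)
  finally show ?thesis .
qed

lemma dirichlet_heat_kernel_nonneg:
  assumes "finite K" "0 \<le> t"
  shows "0 \<le> dhk K x y t"
proof (cases "x \<in> K \<and> y \<in> K")
  case True
  then show ?thesis
    using assms measure_pos[of y] laplacian_entry_nonneg
    by (simp add: dirichlet_heat_kernel_eq kernel_exp_nonneg)
qed (simp add: dirichlet_heat_kernel_outside)

lemma dirichlet_heat_kernel_mono:
  assumes "finite K'" "K \<subseteq> K'" "0 \<le> t"
  shows "dhk K x y t \<le> dhk K' x y t"
proof (cases "x \<in> K \<and> y \<in> K")
  case True
  then have "kernel_exp K (laplacian_entry \<mu> \<omega>) t x y \<le> kernel_exp K' (laplacian_entry \<mu> \<omega>) t x y"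
    using assms laplacian_entry_nonneg by (intro kernel_exp_mono) auto
  moreover have "finite K" "x \<in> K'" "y \<in> K'"
    using assms finite_subset True by auto
  ultimately show ?thesis
    using True assms(1) measure_pos[of y] by (simp add: dirichlet_heat_kernel_eq divide_right_mono)
qed (use assms in \<open>simp add: dirichlet_heat_kernel_outside dirichlet_heat_kernel_nonneg\<close>)

lemma sum_dirichlet_heat_kernel_le_1:
  assumes "finite K" "finite F" "0 \<le> t"
  shows "(\<Sum>y\<in>F. dhk K x y t * \<mu> y) \<le> 1"
proof (cases "x \<in> K")
  case True
  have "(\<Sum>y\<in>F. dhk K x y t * \<mu> y) \<le> (\<Sum>y\<in>F \<union> K. dhk K x y t * \<mu> y)"
    using assms measure_pos
    by (intro sum_mono2) (auto intro!: mult_nonneg_nonneg dirichlet_heat_kernel_nonneg intro: less_imp_le)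
  also have "\<dots> = (\<Sum>y\<in>K. dhk K x y t * \<mu> y)"
    using assms by (intro sum.mono_neutral_right) (auto simp: dirichlet_heat_kernel_outside)
  also have "\<dots> = (\<Sum>y\<in>K. kernel_exp K (laplacian_entry \<mu> \<omega>) t x y)"
    using assms True measure_pos[THEN less_imp_neq] by (intro sum.cong) (auto simp: dirichlet_heat_kernel_eq)
  also have "\<dots> \<le> 1"
    using assms True laplacian_entry_nonneg sum_laplacian_entry_le_0
    by (intro sum_kernel_exp_le_1) auto
  finally show ?thesis .
qed (simp add: dirichlet_heat_kernel_outside)

lemma dirichlet_heat_kernel_le:
  assumes "finite K" "0 \<le> t"
  shows "dhk K x y t \<le> 1 / \<mu> y"
  using sum_dirichlet_heat_kernel_le_1[OF assms(1) _ assms(2), of "{y}" x] measure_pos[of y]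
  by (simp add: field_simps)

lemma dirichlet_heat_kernel_add:
  assumes "finite K"
  shows "dhk K x y (s + t) = (\<Sum>z\<in>K. dhk K x z s * dhk K z y t * \<mu> z)"
proof (cases "x \<in> K \<and> y \<in> K")
  case True
  let ?e = "kernel_exp K (laplacian_entry \<mu> \<omega>)"
  have "dhk K x y (s + t) = (\<Sum>z\<in>K. ?e s x z * ?e t z y) / \<mu> y"
    using True assms by (simp add: dirichlet_heat_kernel_eq kernel_exp_add)
  also have "\<dots> = (\<Sum>z\<in>K. dhk K x z s * dhk K z y t * \<mu> z)"
    unfolding sum_divide_distrib
  proof (rule sum.cong)
    fix z assume "z \<in> K"
    then show "?e s x z * ?e t z y / \<mu> y = dhk K x z s * dhk K z y t * \<mu> z"
      using True assms measure_pos[of z] by (simp add: dirichlet_heat_kernel_eq)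
  qed simp
  finally show ?thesis .
qed (auto simp: dirichlet_heat_kernel_outside)

lemma bdd_above_dirichlet_heat_kernel:
  "0 \<le> t \<Longrightarrow> bdd_above ((\<lambda>K. dhk K x y t) ` {K. finite K})"
  using dirichlet_heat_kernel_le by (intro bdd_aboveI2) auto

lemma dirichlet_le_heat_kernel:
  "finite K \<Longrightarrow> 0 \<le> t \<Longrightarrow> dhk K x y t \<le> hk x y t"
  unfolding heat_kernel_def by (intro cSUP_upper bdd_above_dirichlet_heat_kernel) auto

lemma heat_kernel_nonneg: "0 \<le> t \<Longrightarrow> 0 \<le> hk x y t"
  using dirichlet_le_heat_kernel[of "{}" t x y] by (simp add: dirichlet_heat_kernel_outside)

lemma dirichlet_heat_kernel_tendsto:
  assumes "0 \<le> t"
  shows "((\<lambda>K. dhk K x y t) \<longlongrightarrow> hk x y t) (finite_subsets_at_top UNIV)"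
proof (rule increasing_tendsto)
  show "\<forall>\<^sub>F K in finite_subsets_at_top UNIV. dhk K x y t \<le> hk x y t"
    using assms by (auto intro!: eventually_finite_subsets_at_top_weakI dirichlet_le_heat_kernel)
next
  fix r assume "r < hk x y t"
  then obtain K where K: "finite K" "r < dhk K x y t"
    using less_cSUP_iff[OF _ bdd_above_dirichlet_heat_kernel[OF assms], of r x y]
    unfolding heat_kernel_def by auto
  have "r < dhk K' x y t" if "finite K'" "K \<subseteq> K'" for K'
    using K(2) dirichlet_heat_kernel_mono[OF that assms] by (rule order_less_le_trans)
  then show "\<forall>\<^sub>F K in finite_subsets_at_top UNIV. r < dhk K x y t"
    using K(1) by (auto simp: eventually_finite_subsets_at_top)
qed

lemma sum_heat_kernel_le_1:
  assumes "finite F" "0 \<le> t"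
  shows "(\<Sum>y\<in>F. hk x y t * \<mu> y) \<le> 1"
proof (rule tendsto_upperbound)
  show "((\<lambda>K. \<Sum>y\<in>F. dhk K x y t * \<mu> y) \<longlongrightarrow> (\<Sum>y\<in>F. hk x y t * \<mu> y)) (finite_subsets_at_top UNIV)"
    using assms(2) by (intro tendsto_intros dirichlet_heat_kernel_tendsto)
  show "\<forall>\<^sub>F K in finite_subsets_at_top UNIV. (\<Sum>y\<in>F. dhk K x y t * \<mu> y) \<le> 1"
    using assms by (intro eventually_finite_subsets_at_top_weakI sum_dirichlet_heat_kernel_le_1)
qed simp

lemma sum_heat_kernel_chapman_kolmogorov:
  assumes "finite F" "0 \<le> s" "0 \<le> t"
  shows "(\<Sum>z\<in>F. hk x z s * hk z y t * \<mu> z) \<le> hk x y (s + t)"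
proof (rule tendsto_upperbound)
  show "((\<lambda>K. \<Sum>z\<in>F. dhk K x z s * dhk K z y t * \<mu> z) \<longlongrightarrow> (\<Sum>z\<in>F. hk x z s * hk z y t * \<mu> z))
      (finite_subsets_at_top UNIV)"
    using assms(2,3) by (intro tendsto_intros dirichlet_heat_kernel_tendsto)
  have "(\<Sum>z\<in>F. dhk K x z s * dhk K z y t * \<mu> z) \<le> hk x y (s + t)" if "finite K" for K
  proof -
    have "(\<Sum>z\<in>F. dhk K x z s * dhk K z y t * \<mu> z) \<le> (\<Sum>z\<in>F \<union> K. dhk K x z s * dhk K z y t * \<mu> z)"
      using assms that measure_pos
      by (intro sum_mono2) (auto intro!: mult_nonneg_nonneg dirichlet_heat_kernel_nonneg intro: less_imp_le)
    also have "\<dots> = dhk K x y (s + t)"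
      unfolding dirichlet_heat_kernel_add[OF that] using assms that
      by (intro sum.mono_neutral_right) (auto simp: dirichlet_heat_kernel_outside)
    also have "\<dots> \<le> hk x y (s + t)"
      using that assms by (intro dirichlet_le_heat_kernel) auto
    finally show ?thesis .
  qed
  then show "\<forall>\<^sub>F K in finite_subsets_at_top UNIV.
      (\<Sum>z\<in>F. dhk K x z s * dhk K z y t * \<mu> z) \<le> hk x y (s + t)"
    by (intro eventually_finite_subsets_at_top_weakI)
qed simp

lemma borel_measurable_heat_kernel:
  "(\<lambda>t. if 0 < t then hk x y t else 0) \<in> borel_measurable borel"
proof -
  have "(\<lambda>t. SUP K\<in>{K. finite K}. if 0 < t then dhk K x y t else 0) \<in> borel_measurable borel"
  proof (rule borel_measurable_cSUP)
    show "countable {K :: 'a set. finite K}" by (rule countable_Collect_finite)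
    show "bdd_above ((\<lambda>K. if 0 < t then dhk K x y t else 0) ` {K. finite K})" for t
      using bdd_above_dirichlet_heat_kernel[of t x y] by (cases "0 < t") auto
    show "(\<lambda>t. if 0 < t then dhk K x y t else 0) \<in> borel_measurable borel" for K
      unfolding dirichlet_heat_kernel_def by measurable
  qed
  also have "(\<lambda>t. SUP K\<in>{K. finite K}. if 0 < t then dhk K x y t else 0)
      = (\<lambda>t. if 0 < t then hk x y t else 0)"
  proof
    fix t :: real
    have "(SUP K\<in>{K :: 'a set. finite K}. 0 :: real) = 0"
      by (rule cSUP_const) (auto intro: finite.emptyI)
    then show "(SUP K\<in>{K. finite K}. if 0 < t then dhk K x y t else 0) = (if 0 < t then hk x y t else 0)"
      by (simp add: heat_kernel_def)
  qed
  finally show ?thesis .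
qed

end

section \<open>Mild solutions for sub-Markov kernels\<close>

locale sub_markov_kernel =
  fixes P :: "real \<Rightarrow> 'a::countable \<Rightarrow> 'a \<Rightarrow> ennreal"
  assumes kernel_measurable [measurable]: "(\<lambda>t. P t x y) \<in> borel_measurable borel"
    and kernel_mass: "0 < t \<Longrightarrow> (\<integral>\<^sup>+y. P t x y \<partial>count_space UNIV) \<le> 1"
    and chapman_kolmogorov:
      "0 < s \<Longrightarrow> 0 < t \<Longrightarrow> (\<integral>\<^sup>+z. P s x z * P t z y \<partial>count_space UNIV) \<le> P (s + t) x y"
begin

definition kernel_op :: "real \<Rightarrow> ('a \<Rightarrow> ennreal) \<Rightarrow> 'a \<Rightarrow> ennreal" where
  "kernel_op t g x = (\<integral>\<^sup>+y. P t x y * g y \<partial>count_space UNIV)"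

lemma kernel_op_mono: "(\<And>y. g y \<le> h y) \<Longrightarrow> kernel_op t g x \<le> kernel_op t h x"
  unfolding kernel_op_def by (intro nn_integral_mono mult_left_mono) auto

lemma kernel_op_cmult: "kernel_op t (\<lambda>y. c * g y) x = c * kernel_op t g x"
  unfolding kernel_op_def by (subst nn_integral_cmult[symmetric]) (auto simp: mult_ac)

lemma kernel_op_le_const:
  assumes "0 < t" "\<And>y. g y \<le> c"
  shows "kernel_op t g x \<le> c"
proof -
  have "kernel_op t g x \<le> (\<integral>\<^sup>+y. P t x y * c \<partial>count_space UNIV)"
    unfolding kernel_op_def using assms(2) by (intro nn_integral_mono mult_left_mono) auto
  also have "\<dots> = (\<integral>\<^sup>+y. P t x y \<partial>count_space UNIV) * c"
    by (simp add: nn_integral_multc)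
  also have "\<dots> \<le> 1 * c"
    using assms(1) by (intro mult_right_mono kernel_mass) auto
  finally show ?thesis by simp
qed

lemma kernel_op_kernel_op_le:
  assumes "0 < s" "0 < t"
  shows "kernel_op s (kernel_op t g) x \<le> kernel_op (s + t) g x"
proof -
  have "kernel_op s (kernel_op t g) x
      = (\<integral>\<^sup>+z. \<integral>\<^sup>+y. P s x z * (P t z y * g y) \<partial>count_space UNIV \<partial>count_space UNIV)"
    unfolding kernel_op_def by (subst nn_integral_cmult) auto
  also have "\<dots> = (\<integral>\<^sup>+y. \<integral>\<^sup>+z. P s x z * (P t z y * g y) \<partial>count_space UNIV \<partial>count_space UNIV)"
    by (intro nn_integral_count_space_nn_integral) auto
  also have "\<dots> = (\<integral>\<^sup>+y. (\<integral>\<^sup>+z. P s x z * P t z y \<partial>count_space UNIV) * g y \<partial>count_space UNIV)"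
    by (subst nn_integral_multc[symmetric]) (auto simp: mult_ac)
  also have "\<dots> \<le> kernel_op (s + t) g x"
    unfolding kernel_op_def using chapman_kolmogorov[OF assms]
    by (intro nn_integral_mono mult_right_mono) auto
  finally show ?thesis .
qed

lemma kernel_op_measurable [measurable]:
  assumes [measurable]: "\<And>y. (\<lambda>p. g p y) \<in> borel_measurable M" "h \<in> borel_measurable M"
  shows "(\<lambda>p. kernel_op (h p) (g p) x) \<in> borel_measurable M"
  unfolding kernel_op_def
proof (rule borel_measurable_nn_integral_count_space)
  fix y
  have [measurable]: "(\<lambda>p. P (h p) x y) \<in> borel_measurable M"
    by (rule measurable_compose[OF assms(2) kernel_measurable])
  show "(\<lambda>p. P (h p) x y * g p y) \<in> borel_measurable M" by measurable
qed

lemma kernel_op_SUP: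
  assumes "\<And>y. incseq (\<lambda>n. g n y)"
  shows "kernel_op t (\<lambda>y. SUP n. g n y) x = (SUP n :: nat. kernel_op t (g n) x)"
proof -
  have "kernel_op t (\<lambda>y. SUP n. g n y) x = (\<integral>\<^sup>+y. (SUP n. P t x y * g n y) \<partial>count_space UNIV)"
    unfolding kernel_op_def by (simp add: SUP_mult_left_ennreal)
  also have "\<dots> = (SUP n. kernel_op t (g n) x)"
    unfolding kernel_op_def using assms
    by (intro nn_integral_monotone_convergence_SUP) (auto simp: incseq_def le_fun_def intro!: mult_left_mono)
  finally show ?thesis .
qed

definition mild_map ::
    "(ennreal \<Rightarrow> ennreal) \<Rightarrow> ('a \<Rightarrow> ennreal) \<Rightarrow> ('a \<Rightarrow> real \<Rightarrow> ennreal) \<Rightarrow> 'a \<Rightarrow> real \<Rightarrow> ennreal" where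
  "mild_map G g u x t =
     kernel_op t g x + (\<integral>\<^sup>+s\<in>{0<..<t}. kernel_op (t - s) (\<lambda>y. G (u y s)) x \<partial>lborel)"

lemma mild_map_measurable:
  assumes [measurable]: "G \<in> borel_measurable borel" "\<And>y. u y \<in> borel_measurable borel"
  shows "mild_map G g u x \<in> borel_measurable borel"
proof -
  have "(\<lambda>p. kernel_op (fst p - snd p) (\<lambda>y. G (u y (snd p))) x * (if 0 < snd p \<and> snd p < fst p then 1 else 0))
      \<in> borel_measurable (borel \<Otimes>\<^sub>M lborel)"
    by measurable
  then have "(\<lambda>t. \<integral>\<^sup>+s\<in>{0<..<t}. kernel_op (t - s) (\<lambda>y. G (u y s)) x \<partial>lborel) \<in> borel_measurable borel"
    by (intro lborel.borel_measurable_nn_integral) (simp add: case_prod_beta' indicator_def of_bool_def)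
  then show ?thesis
    unfolding mild_map_def by measurable
qed

lemma mild_map_mono:
  assumes "mono G" "\<And>y s. u y s \<le> v y s"
  shows "mild_map G g u x t \<le> mild_map G g v x t"
  unfolding mild_map_def using assms
  by (intro add_left_mono nn_integral_mono mult_right_mono kernel_op_mono) (auto dest: monoD)

text \<open>The supersolution is preserved because
  \<open>\<integral>\<^sub>0\<^sup>t P\<^sub>t\<^sub>-\<^sub>s (L e\<^sup>L\<^sup>s P\<^sub>s g) ds \<le> \<integral>\<^sub>0\<^sup>t L e\<^sup>L\<^sup>s ds \<cdot> P\<^sub>t g = (e\<^sup>L\<^sup>t - 1) P\<^sub>t g\<close>.\<close>

lemma mild_map_supersolution:
  assumes "0 \<le> L" "\<And>v. G v \<le> ennreal L * v"
    and "\<And>y s. 0 < s \<Longrightarrow> u y s \<le> ennreal (exp (L * s)) * kernel_op s g y" "0 < t"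
  shows "mild_map G g u x t \<le> ennreal (exp (L * t)) * kernel_op t g x"
proof -
  have "(\<integral>\<^sup>+s\<in>{0<..<t}. kernel_op (t - s) (\<lambda>y. G (u y s)) x \<partial>lborel)
      \<le> (\<integral>\<^sup>+s. ennreal (L * exp (L * s)) * indicator {0..t} s * kernel_op t g x \<partial>lborel)"
  proof (rule nn_integral_mono)
    fix s
    show "kernel_op (t - s) (\<lambda>y. G (u y s)) x * indicator {0<..<t} s
      \<le> ennreal (L * exp (L * s)) * indicator {0..t} s * kernel_op t g x"
    proof (cases "s \<in> {0<..<t}")
      case True
      have "G (u y s) \<le> ennreal (L * exp (L * s)) * kernel_op s g y" for y
      proof -
        have "G (u y s) \<le> ennreal L * u y s" by (rule assms)
        also have "\<dots> \<le> ennreal L * (ennreal (exp (L * s)) * kernel_op s g y)"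
          using True by (intro mult_left_mono assms) auto
        finally show ?thesis using assms(1) by (simp add: ennreal_mult mult.assoc)
      qed
      then have "kernel_op (t - s) (\<lambda>y. G (u y s)) x
          \<le> ennreal (L * exp (L * s)) * kernel_op (t - s) (kernel_op s g) x"
        unfolding kernel_op_cmult[symmetric] by (rule kernel_op_mono)
      also have "\<dots> \<le> ennreal (L * exp (L * s)) * kernel_op t g x"
        using True kernel_op_kernel_op_le[of "t - s" s g x] by (intro mult_left_mono) auto
      finally show ?thesis using True by simp
    qed simp
  qed
  also have "\<dots> = (\<integral>\<^sup>+s. ennreal (L * exp (L * s)) * indicator {0..t} s \<partial>lborel) * kernel_op t g x"
    by (intro nn_integral_multc) measurable
  also have "(\<integral>\<^sup>+s. ennreal (L * exp (L * s)) * indicator {0..t} s \<partial>lborel) = ennreal (exp (L * t) - exp (L * 0))"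
    using assms(1,4)
    by (intro nn_integral_FTC_Icc) (auto intro!: derivative_eq_intros)
  finally have "mild_map G g u x t \<le> kernel_op t g x + ennreal (exp (L * t) - 1) * kernel_op t g x"
    unfolding mild_map_def by (simp add: add_left_mono)
  also have "\<dots> = (ennreal 1 + ennreal (exp (L * t) - 1)) * kernel_op t g x"
    by (simp add: distrib_right)
  also have "ennreal 1 + ennreal (exp (L * t) - 1) = ennreal (exp (L * t))"
    using assms(1,4) by (subst ennreal_plus[symmetric]) auto
  finally show ?thesis .
qed

lemma mild_map_fixpoint_exists:
  assumes G: "sup_continuous G" "G \<in> borel_measurable borel"
    and L: "0 \<le> L" "\<And>v. G v \<le> ennreal L * v"
  obtains u where "\<And>x. u x \<in> borel_measurable borel"
    and "\<And>x t. u x t = mild_map G g u x t"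
    and "\<And>x t. 0 < t \<Longrightarrow> u x t \<le> ennreal (exp (L * t)) * kernel_op t g x"
proof -
  define U where "U n = (mild_map G g ^^ n) (\<lambda>_ _. 0)" for n
  have U_Suc: "U (Suc n) = mild_map G g (U n)" for n by (simp add: U_def)
  have mono: "mono G" using G(1) by (rule sup_continuous_mono)
  have U_meas [measurable]: "U n x \<in> borel_measurable borel" for n x
  proof (induction n arbitrary: x)
    case (Suc n)
    then show ?case unfolding U_Suc by (intro mild_map_measurable G(2))
  qed (simp add: U_def)
  have "U n x t \<le> U (Suc n) x t" for n x t
  proof (induction n arbitrary: x t)
    case (Suc n)
    then show ?case unfolding U_Suc[of n] U_Suc[of "Suc n"] by (intro mild_map_mono mono)
  qed (simp add: U_def)
  then have U_inc: "incseq (\<lambda>n. U n x t)" for x t by (rule incseq_SucI)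
  have U_le: "U n x t \<le> ennreal (exp (L * t)) * kernel_op t g x" if "0 < t" for n x t
    using that
  proof (induction n arbitrary: x t)
    case (Suc n)
    show ?case unfolding U_Suc by (intro mild_map_supersolution L Suc)
  qed (simp add: U_def)
  define u where "u x t = (SUP n. U n x t)" for x t
  have GU_inc: "incseq (\<lambda>n. G (U n x t))" for x t
    by (intro incseq_def[THEN iffD2] allI impI monoD[OF mono] incseqD[OF U_inc])
  have [measurable]: "G \<in> borel_measurable borel" by (rule G(2))
  have "mild_map G g u x t = u x t" for x t
  proof -
    have "(\<integral>\<^sup>+s\<in>{0<..<t}. kernel_op (t - s) (\<lambda>y. G (u y s)) x \<partial>lborel)
        = (\<integral>\<^sup>+s. (SUP n. kernel_op (t - s) (\<lambda>y. G (U n y s)) x * indicator {0<..<t} s) \<partial>lborel)"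
      using GU_inc by (simp add: u_def sup_continuousD[OF G(1) U_inc] kernel_op_SUP SUP_mult_right_ennreal)
    also have "\<dots> = (SUP n. \<integral>\<^sup>+s\<in>{0<..<t}. kernel_op (t - s) (\<lambda>y. G (U n y s)) x \<partial>lborel)"
    proof (rule nn_integral_monotone_convergence_SUP)
      show "incseq (\<lambda>n s. kernel_op (t - s) (\<lambda>y. G (U n y s)) x * indicator {0<..<t} s)"
        using GU_inc by (auto simp: incseq_def le_fun_def intro!: mult_right_mono kernel_op_mono)
    qed measurable
    finally have "mild_map G g u x t = (SUP n. mild_map G g (U n) x t)"
      unfolding mild_map_def by (simp add: ennreal_SUP_add_right)
    also have "\<dots> = (SUP n. U (Suc n) x t)" by (simp add: U_Suc)
    also have "\<dots> = u x t"
      unfolding u_def using incseq_SucD[OF U_inc] by (intro antisym SUP_mono) auto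
    finally show ?thesis .
  qed
  moreover have "u x \<in> borel_measurable borel" for x
    unfolding u_def by measurable
  moreover have "u x t \<le> ennreal (exp (L * t)) * kernel_op t g x" if "0 < t" for x t
    unfolding u_def using U_le[OF that] by (intro SUP_least)
  ultimately show ?thesis using that by metis
qed

end

section \<open>Global existence\<close>

lemma lipschitz_on_lipschitz_const:
  fixes f :: "real \<Rightarrow> real"
  assumes "L'-lipschitz_on S f"
  shows "(lipschitz_const S f)-lipschitz_on S f"
proof -
  let ?A = "{L. L-lipschitz_on S f}"
  have bdd: "bdd_below ?A"
    by (rule bdd_belowI[of _ 0]) (auto dest: lipschitz_on_nonneg)
  have ne: "?A \<noteq> {}" using assms by auto
  have Inf: "(Inf ?A)-lipschitz_on S f"
  proof (rule lipschitz_onI)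
    fix x y assume xy: "x \<in> S" "y \<in> S"
    show "dist (f x) (f y) \<le> Inf ?A * dist x y"
    proof (cases "x = y")
      case False
      have "dist (f x) (f y) / dist x y \<le> Inf ?A"
        using ne xy False
        by (intro cInf_greatest) (auto simp: divide_le_eq dest: lipschitz_onD)
      then show ?thesis using False by (simp add: divide_le_eq)
    qed simp
  next
    show "0 \<le> Inf ?A" using ne by (intro cInf_greatest) (auto dest: lipschitz_on_nonneg)
  qed
  moreover have "lipschitz_const S f = Inf ?A"
    unfolding lipschitz_const_def using Inf bdd by (intro Least_equality cInf_lower) auto
  ultimately show ?thesis by simp
qed

text \<open>Cutting \<open>f\<close> off at \<open>\<delta>\<close> makes \<open>f r \<le> L r\<close> hold globally; the supersolution
  never exceeds \<open>\<delta>\<close>, so the solution does not see the cutoff.\<close>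

definition truncation :: "(real \<Rightarrow> real) \<Rightarrow> real \<Rightarrow> ennreal \<Rightarrow> ennreal" where
  "truncation f \<delta> v = ennreal (f (enn2real (min v (ennreal \<delta>))))"

lemma truncation_ennreal: "0 \<le> r \<Longrightarrow> r \<le> \<delta> \<Longrightarrow> truncation f \<delta> (ennreal r) = ennreal (f r)"
  by (simp add: truncation_def min_def ennreal_le_iff2)

lemma enn2real_min_le:
  assumes "0 \<le> \<delta>"
  shows "enn2real (min v (ennreal \<delta>)) \<le> \<delta>"
  using enn2real_mono[of "min v (ennreal \<delta>)" "ennreal \<delta>"] assms by simp

lemma mono_truncation:
  assumes "mono_on {0..} f"
  shows "mono (truncation f \<delta>)"
  unfolding truncation_def
  by (intro monoI ennreal_leI mono_onD[OF assms] enn2real_mono min.mono order_refl)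
    (auto simp: min_less_iff_disj)

lemma tendsto_truncation:
  assumes "continuous_on {0..} f" "(X \<longlongrightarrow> v) F"
  shows "((\<lambda>n. truncation f \<delta> (X n)) \<longlongrightarrow> truncation f \<delta> v) F"
proof -
  have "((\<lambda>n. min (X n) (ennreal \<delta>)) \<longlongrightarrow> min v (ennreal \<delta>)) F"
    by (intro tendsto_min assms(2) tendsto_const)
  moreover have "min v (ennreal \<delta>) = ennreal (enn2real (min v (ennreal \<delta>)))"
    by (simp add: min_less_iff_disj)
  ultimately have "((\<lambda>n. enn2real (min (X n) (ennreal \<delta>))) \<longlongrightarrow> enn2real (min v (ennreal \<delta>))) F"
    by (intro tendsto_enn2real) auto
  then have "((\<lambda>n. f (enn2real (min (X n) (ennreal \<delta>)))) \<longlongrightarrow> f (enn2real (min v (ennreal \<delta>)))) F"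
    by (rule continuous_on_tendsto_compose[OF assms(1)]) auto
  then show ?thesis
    unfolding truncation_def by (intro tendsto_ennrealI)
qed

lemma sup_continuous_truncation:
  assumes "continuous_on {0..} f" "mono_on {0..} f"
  shows "sup_continuous (truncation f \<delta>)"
  unfolding sup_continuous_def
proof (intro allI impI)
  fix X :: "nat \<Rightarrow> ennreal" assume X: "incseq X"
  have "(\<lambda>n. truncation f \<delta> (X n)) \<longlonglongrightarrow> truncation f \<delta> (SUP n. X n)"
    by (rule tendsto_truncation[OF assms(1) LIMSEQ_SUP[OF X]])
  moreover have "incseq (\<lambda>n. truncation f \<delta> (X n))"
    by (intro incseq_def[THEN iffD2] allI impI monoD[OF mono_truncation[OF assms(2)]] incseqD[OF X])
  ultimately show "truncation f \<delta> (SUP n. X n) = (SUP n. truncation f \<delta> (X n))"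
    using LIMSEQ_SUP LIMSEQ_unique by blast
qed

lemma borel_measurable_truncation:
  assumes "continuous_on {0..} f"
  shows "truncation f \<delta> \<in> borel_measurable borel"
  by (intro borel_measurable_continuous_onI continuous_at_imp_continuous_on)
    (auto simp: isCont_def intro!: tendsto_truncation[OF assms] tendsto_ident_at)

lemma truncation_le:
  assumes "0 \<le> L" "0 \<le> \<delta>" "\<And>r. 0 \<le> r \<Longrightarrow> r \<le> \<delta> \<Longrightarrow> f r \<le> L * r"
  shows "truncation f \<delta> v \<le> ennreal L * v"
proof -
  have "truncation f \<delta> v \<le> ennreal (L * enn2real (min v (ennreal \<delta>)))"
    unfolding truncation_def using assms(2) by (intro ennreal_leI assms(3) enn2real_min_le) auto
  also have "\<dots> = ennreal L * min v (ennreal \<delta>)"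
    using assms(1) by (simp add: ennreal_mult min_less_iff_disj)
  also have "\<dots> \<le> ennreal L * v"
    by (intro mult_left_mono) auto
  finally show ?thesis .
qed

context weighted_graph
begin

definition heat_transition :: "real \<Rightarrow> 'a \<Rightarrow> 'a \<Rightarrow> ennreal" where
  "heat_transition t x y = ennreal ((if 0 < t then hk x y t else 0) * \<mu> y)"

sublocale sub_markov_kernel heat_transition
proof
  show "(\<lambda>t. heat_transition t x y) \<in> borel_measurable borel" for x y
    using borel_measurable_heat_kernel[of x y] unfolding heat_transition_def by measurable
  show "(\<integral>\<^sup>+y. heat_transition t x y \<partial>count_space UNIV) \<le> 1" if "0 < t" for t x
  proof -
    have "(\<integral>\<^sup>+y. ennreal (hk x y t * \<mu> y) \<partial>count_space UNIV) \<le> ennreal 1"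
      using that measure_pos sum_heat_kernel_le_1
      by (intro nn_integral_count_space_le mult_nonneg_nonneg heat_kernel_nonneg) (auto intro: less_imp_le)
    then show ?thesis using that by (simp add: heat_transition_def)
  qed
  show "(\<integral>\<^sup>+z. heat_transition s x z * heat_transition t z y \<partial>count_space UNIV) \<le> heat_transition (s + t) x y"
    if "0 < s" "0 < t" for s t x y
  proof -
    have "heat_transition s x z * heat_transition t z y = ennreal (hk x z s * hk z y t * \<mu> z * \<mu> y)" for z
      using that measure_pos heat_kernel_nonneg
      by (simp add: heat_transition_def ennreal_mult[symmetric] less_imp_le mult_ac)
    moreover have "(\<integral>\<^sup>+z. ennreal (hk x z s * hk z y t * \<mu> z * \<mu> y) \<partial>count_space UNIV)
        \<le> ennreal (hk x y (s + t) * \<mu> y)"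
    proof (rule nn_integral_count_space_le)
      show "0 \<le> hk x z s * hk z y t * \<mu> z * \<mu> y" for z
        using that measure_pos heat_kernel_nonneg by (simp add: less_imp_le)
      show "(\<Sum>z\<in>F. hk x z s * hk z y t * \<mu> z * \<mu> y) \<le> hk x y (s + t) * \<mu> y" if "finite F" for F
        unfolding sum_distrib_right[symmetric]
        using \<open>0 < s\<close> \<open>0 < t\<close> that measure_pos[of y]
        by (intro mult_right_mono sum_heat_kernel_chapman_kolmogorov) auto
    qed
    ultimately show ?thesis using that by (simp add: heat_transition_def)
  qed
qed

lemma infsum_heat_kernel_eq:
  assumes "0 < t" "\<And>y. 0 \<le> g y"
  shows "(\<Sum>\<^sub>\<infinity>y. hk x y t * g y * \<mu> y) = enn2real (kernel_op t (\<lambda>y. ennreal (g y)) x)"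
proof -
  have "0 \<le> hk x y t * g y * \<mu> y" for y
    using assms measure_pos[of y] heat_kernel_nonneg[of t x y] by simp
  moreover have "ennreal (hk x y t * g y * \<mu> y) = heat_transition t x y * ennreal (g y)" for y
    using assms measure_pos[of y] heat_kernel_nonneg[of t x y]
    by (simp add: heat_transition_def ennreal_mult[symmetric] mult_ac)
  ultimately show ?thesis
    by (simp add: infsum_eq_enn2real_nn_integral kernel_op_def)
qed

lemma kernel_op_le_ell1_norm:
  assumes "0 < t" "\<And>y. hk x y t \<le> c" "0 \<le> c" "g \<in> ell1 \<mu>" "\<And>y. 0 \<le> g y"
  shows "kernel_op t (\<lambda>y. ennreal (g y)) x \<le> ennreal (c * ell1_norm \<mu> g)"
proof -
  have "kernel_op t (\<lambda>y. ennreal (g y)) x \<le> (\<integral>\<^sup>+y. ennreal c * ennreal (\<bar>g y\<bar> * \<mu> y) \<partial>count_space UNIV)"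
    unfolding kernel_op_def
  proof (rule nn_integral_mono)
    fix y
    have "hk x y t * \<mu> y * g y \<le> c * \<mu> y * g y"
      using assms(2,5) measure_pos[of y] by (intro mult_right_mono) auto
    then show "heat_transition t x y * ennreal (g y) \<le> ennreal c * ennreal (\<bar>g y\<bar> * \<mu> y)"
      using assms measure_pos[of y] heat_kernel_nonneg[of t x y]
      by (simp add: heat_transition_def ennreal_mult[symmetric] mult_ac ennreal_leI)
  qed
  also have "\<dots> = ennreal c * (\<integral>\<^sup>+y. ennreal (\<bar>g y\<bar> * \<mu> y) \<partial>count_space UNIV)"
    by (intro nn_integral_cmult) auto
  also have "(\<integral>\<^sup>+y. ennreal (\<bar>g y\<bar> * \<mu> y) \<partial>count_space UNIV) = ennreal (ell1_norm \<mu> g)"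
    unfolding ell1_norm_def using assms(4) measure_pos
    by (intro nn_integral_count_space_eq_infsum) (auto simp: ell1_def less_imp_le)
  finally show ?thesis using assms(3) by (simp add: ennreal_mult')
qed

lemma global_solution_of_fixpoint:
  fixes U :: "'a \<Rightarrow> real \<Rightarrow> ennreal"
  assumes f: "continuous_on {0..} f" "\<And>r. 0 \<le> r \<Longrightarrow> 0 \<le> f r" "mono_on {0..} f"
    and "0 \<le> \<delta>" and u0: "\<And>x. 0 \<le> u\<^sub>0 x"
    and U_meas: "\<And>x. U x \<in> borel_measurable borel"
    and U_eq: "\<And>x t. U x t = mild_map (truncation f \<delta>) (\<lambda>y. ennreal (u\<^sub>0 y)) U x t"
    and U_le: "\<And>x t. 0 < t \<Longrightarrow> U x t \<le> ennreal \<delta>"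
  shows "global_solution \<mu> \<omega> f u\<^sub>0 (\<lambda>x t. enn2real (U x t))"
proof -
  define u where "u x t = enn2real (U x t)" for x t
  have time: "time_interval \<infinity> = {0<..}" by (auto simp: time_interval_def)
  have u_nonneg: "0 \<le> u x t" for x t by (simp add: u_def)
  have u_le: "u x t \<le> \<delta>" if "0 < t" for x t
    using enn2real_mono[OF U_le[OF that]] assms(4) by (simp add: u_def)
  have U_u: "U x t = ennreal (u x t)" if "0 < t" for x t
    using U_le[OF that, of x] by (simp add: u_def le_less_trans)
  have Linf: "u \<in> Linf_ell_infinity \<infinity>"
    unfolding Linf_ell_infinity_def time
  proof (intro CollectI conjI ballI allI exI)
    fix t :: real assume "t \<in> {0<..}"
    then show "(\<lambda>x. u x t) \<in> ell_infinity"
      using u_nonneg u_le by (auto simp: ell_infinity_def intro!: boundedI[of _ \<delta>])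
  next
    fix x
    have "u x \<in> borel_measurable borel" unfolding u_def[abs_def] using U_meas by measurable
    then have "u x \<in> borel_measurable lebesgue" by (intro measurable_completion) simp
    then show "u x \<in> borel_measurable (lebesgue_on {0<..})" by (rule measurable_restrict_space1)
  next
    show "AE t in lebesgue_on {0<..}. ell_infinity_norm (\<lambda>x. u x t) \<le> \<delta>"
      using u_nonneg u_le by (intro AE_I2) (auto simp: ell_infinity_norm_def intro!: cSUP_least)
  qed
  have eq: "u x t = (\<Sum>\<^sub>\<infinity>y. hk x y t * u\<^sub>0 y * \<mu> y)
      + (LINT s:{0<..<t}|lebesgue. \<Sum>\<^sub>\<infinity>y. hk x y (t - s) * f (u y s) * \<mu> y)" if "0 < t" for x t
  proof -
    let ?A = "\<lambda>s. kernel_op (t - s) (\<lambda>y. truncation f \<delta> (U y s)) x * indicator {0<..<t} s"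
    have fin: "?A s \<le> ennreal (f \<delta>)" for s
    proof (cases "s \<in> {0<..<t}")
      case True
      have "truncation f \<delta> (U y s) \<le> ennreal (f \<delta>)" for y
        unfolding truncation_def using \<open>0 \<le> \<delta>\<close>
        by (intro ennreal_leI mono_onD[OF f(3)] enn2real_min_le) auto
      with True show ?thesis by (auto intro!: kernel_op_le_const)
    qed simp
    have trunc: "truncation f \<delta> (U y s) = ennreal (f (u y s))" if "0 < s" for y s
      using that u_nonneg u_le by (simp add: U_u truncation_ennreal)
    have A: "?A s = ennreal (indicator {0<..<t} s * (\<Sum>\<^sub>\<infinity>y. hk x y (t - s) * f (u y s) * \<mu> y))" for s
    proof (cases "s \<in> {0<..<t}")
      case True
      with f(2) u_nonneg fin[of s] show ?thesis
        by (simp add: trunc infsum_heat_kernel_eq le_less_trans)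
    qed simp
    have "?A \<in> borel_measurable borel"
    proof -
      have [measurable]: "truncation f \<delta> \<in> borel_measurable borel"
        by (rule borel_measurable_truncation[OF f(1)])
      note [measurable] = U_meas
      show ?thesis by measurable
    qed
    then have "(\<lambda>s. enn2real (?A s)) \<in> borel_measurable borel" by measurable
    then have "(\<lambda>s. enn2real (?A s)) \<in> borel_measurable lebesgue"
      by (intro measurable_completion) simp
    moreover have "enn2real (?A s)
        = indicator {0<..<t} s * (\<Sum>\<^sub>\<infinity>y. hk x y (t - s) * f (u y s) * \<mu> y)" for s
      using f(2) u_nonneg by (cases "s \<in> {0<..<t}") (simp_all add: trunc infsum_heat_kernel_eq)
    ultimately have int: "(LINT s:{0<..<t}|lebesgue. \<Sum>\<^sub>\<infinity>y. hk x y (t - s) * f (u y s) * \<mu> y)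
        = enn2real (\<integral>\<^sup>+s. ?A s \<partial>lebesgue)"
      unfolding set_lebesgue_integral_def A using f(2) u_nonneg
      by (subst integral_eq_nn_integral) (auto simp: indicator_def infsum_heat_kernel_eq)
    have "u x t = enn2real (kernel_op t (\<lambda>y. ennreal (u\<^sub>0 y)) x + (\<integral>\<^sup>+s. ?A s \<partial>lborel))"
      unfolding u_def by (subst U_eq) (simp add: mild_map_def)
    moreover have "kernel_op t (\<lambda>y. ennreal (u\<^sub>0 y)) x + (\<integral>\<^sup>+s. ?A s \<partial>lborel) < top"
      using U_le[OF that, of x] unfolding U_eq[of x t] mild_map_def by (rule le_less_trans) simp
    ultimately show ?thesis
      using u0 that by (simp add: int nn_integral_completion enn2real_plus infsum_heat_kernel_eq)
  qed
  show ?thesis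
    unfolding global_solution_def mild_solution_def time u_def[symmetric, abs_def]
    using Linf u_nonneg by (auto intro: eq)
qed

end

theorem theorem3p5:
  fixes \<mu> :: "'a::countable \<Rightarrow> real" and \<omega> :: "'a \<Rightarrow> 'a \<Rightarrow> real"
    and f :: "real \<Rightarrow> real" and u\<^sub>0 :: "'a \<Rightarrow> real"
    and \<delta> L C t\<^sub>0 :: real
  assumes "weighted_graph \<mu> \<omega>"
    and "lambda1 \<mu> \<omega> > 0"
    and "\<And>r. r \<ge> 0 \<Longrightarrow> f r \<ge> 0"
    and "local_lipschitz (UNIV :: real set) {0..} (\<lambda>_. f)"
    and "mono_on {0..} f"
    and "f 0 = 0"
    and "\<delta> > 0"
    and "L = lipschitz_const {0..\<delta>} f"
    and "L = lambda1 \<mu> \<omega>"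
    and "t\<^sub>0 > 0" and "C > 0"
    and "\<And>x y t. t \<ge> t\<^sub>0 \<Longrightarrow> heat_kernel \<mu> \<omega> x y t \<le> C * exp (- lambda1 \<mu> \<omega> * t)"
    and "u\<^sub>0 \<in> ell_infinity \<inter> ell1 \<mu>"
    and "\<And>x. u\<^sub>0 x \<ge> 0"
    and "ell_infinity_norm u\<^sub>0 \<le> \<delta> * exp (- L * t\<^sub>0)"
    and "ell1_norm \<mu> u\<^sub>0 \<le> \<delta> / C"
  shows "\<exists>u. global_solution \<mu> \<omega> f u\<^sub>0 u \<and> u \<in> Linf_ell_infinity \<infinity>"
proof -
  interpret weighted_graph \<mu> \<omega> by fact
  have cont: "continuous_on {0..} f"
    using local_lipschitz_continuous_on[OF assms(4), of 0] by simp
  have "local_lipschitz {0 :: real} {0..\<delta>} (\<lambda>_. f)"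
    using assms(4) by (rule local_lipschitz_subset) auto
  then obtain L' where "L'-lipschitz_on {0..\<delta>} f"
    by (rule local_lipschitz_compact_implies_lipschitz) auto
  then have lip: "L-lipschitz_on {0..\<delta>} f"
    unfolding assms(8) by (rule lipschitz_on_lipschitz_const)
  then have L: "0 \<le> L" by (rule lipschitz_on_nonneg)
  have f_le: "f r \<le> L * r" if "0 \<le> r" "r \<le> \<delta>" for r
    using lipschitz_onD[OF lip, of r 0] that assms(3,6,7) by (auto simp: dist_real_def)
  let ?g = "\<lambda>y. ennreal (u\<^sub>0 y)"
  have super: "ennreal (exp (L * t)) * kernel_op t ?g x \<le> ennreal \<delta>" if "0 < t" for t x
  proof (cases "t\<^sub>0 \<le> t")
    case True
    have "kernel_op t ?g x \<le> ennreal (C * exp (- L * t) * ell1_norm \<mu> u\<^sub>0)"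
      using that assms(11,13,14) assms(12)[OF True]
      by (intro kernel_op_le_ell1_norm) (auto simp: assms(9))
    also have "\<dots> \<le> ennreal (C * exp (- L * t) * (\<delta> / C))"
      using assms(11,16) by (intro ennreal_leI mult_left_mono) auto
    also have "\<dots> = ennreal (exp (- L * t) * \<delta>)"
      using assms(11) by simp
    finally have "ennreal (exp (L * t)) * kernel_op t ?g x
        \<le> ennreal (exp (L * t)) * ennreal (exp (- L * t) * \<delta>)"
      by (rule mult_left_mono) simp
    also have "\<dots> = ennreal \<delta>"
      using assms(7) by (simp add: ennreal_mult[symmetric] mult.assoc[symmetric] exp_add[symmetric])
    finally show ?thesis .
  next
    case False
    have "kernel_op t ?g x \<le> ennreal (\<delta> * exp (- L * t\<^sub>0))"
    proof (rule kernel_op_le_const[OF that])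
      fix y
      obtain B where "\<And>x. \<bar>u\<^sub>0 x\<bar> \<le> B"
        using assms(13) by (auto simp: ell_infinity_def bounded_iff)
      then have "\<bar>u\<^sub>0 y\<bar> \<le> ell_infinity_norm u\<^sub>0"
        unfolding ell_infinity_norm_def by (intro cSUP_upper bdd_aboveI2) auto
      then show "?g y \<le> ennreal (\<delta> * exp (- L * t\<^sub>0))"
        using assms(15) by (intro ennreal_leI) auto
    qed
    then have "ennreal (exp (L * t)) * kernel_op t ?g x
        \<le> ennreal (exp (L * t\<^sub>0)) * ennreal (\<delta> * exp (- L * t\<^sub>0))"
      using False L by (intro mult_mono ennreal_leI) (auto intro: mult_left_mono)
    also have "\<dots> = ennreal \<delta>"
      using assms(7) by (simp add: ennreal_mult[symmetric] exp_minus)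
    finally show ?thesis .
  qed
  obtain U where U: "\<And>x. U x \<in> borel_measurable borel"
      "\<And>x t. U x t = mild_map (truncation f \<delta>) ?g U x t"
      "\<And>x t. 0 < t \<Longrightarrow> U x t \<le> ennreal (exp (L * t)) * kernel_op t ?g x"
  proof (rule mild_map_fixpoint_exists[where g = ?g])
    show "sup_continuous (truncation f \<delta>)" by (rule sup_continuous_truncation[OF cont assms(5)])
    show "truncation f \<delta> \<in> borel_measurable borel" by (rule borel_measurable_truncation[OF cont])
    show "0 \<le> L" by (rule L)
    show "truncation f \<delta> v \<le> ennreal L * v" for v
      using assms(7) by (intro truncation_le L f_le) simp_all
  qed blast
  have "global_solution \<mu> \<omega> f u\<^sub>0 (\<lambda>x t. enn2real (U x t))"
    by (rule global_solution_of_fixpoint[OF cont assms(3,5) less_imp_le[OF assms(7)] assms(14) U(1,2)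
          order_trans[OF U(3) super]])
  then show ?thesis
    unfolding global_solution_def mild_solution_def by blast
qed

end
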